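(* Let $\mathbf{A}=(A;\to,\neg)$ be an inOL-algebra and let $\equiv$ be the relation on $A$ defined by $x\equiv y$ iff $x\preceq y$ and $y\preceq x$. Then $\mathbf{A}$ embeds (as an algebra with operations $\to,\neg$) into the inOL-twist-algebra $[(A;\to)/{\equiv}]^{\bowtie}$ built over the Tarski algebra $(A;\to)/{\equiv}$, whose top element is the class of $a\to a$ for an arbitrary $a\in A$.
   Context: Notation: $|x| := x\to x$; $x\preceq y$ means $x\to y = |x\to y|$; $q(x,y,z) := (x\to y)\to((y\to x)\to((\neg x\to\neg y)\to((\neg y\to\neg x)\to z)))$. An inOL-algebra is an algebra $(A;\to,\neg)$ of type $(2,1)$ satisfying, for all $x,y,z$: (1) $|x|\to y=y$; (2) $x\to(y\to z)=(x\to y)\to(x\to z)=y\to(x\to z)$; (3) $((x\to y)\to x)\to x=|x|$; (4) $x\preceq y\to x$ (i.e. $x\to(y\to x)=|x\to(y\to x)|$); (5) $\neg\neg x=x$; (6) $x\to y=(\neg x\to x)\to y$; (7) $x\to\neg y=\neg(x\to y)$; (8) $q(x,y,x)=q(x,y,y)$. A Tarski algebra is an algebra $(T;\to,1)$ of type $(2,0)$ satisfying: (i) $x\to(y\to x)=1$; (ii) $x\to(y\to z)=(x\to y)\to(x\to z)$; (iii) $x\to y=y\to x=1$ implies $x=y$; (iv) $((x\to y)\to x)\to x=1$. For a Tarski algebra $\mathbf{T}=(T;\to,1)$, the algebra $\mathbf{T}^{\bowtie}$ has universe $\{(a_1,a_2)\in T\times T: a_1\to a_2=a_2\}$ and operations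 $\neg(x_1,x_2):=(x_2,x_1)$ and $(x_1,x_2)\to(y_1,y_2):=(x_1\to y_1,\,x_1\to y_2)$. The relation $\equiv$ is a congruence of $(A;\to)$ and the quotient $(A;\to)/{\equiv}$ is a Tarski algebra. *)

theory Defs
  imports Main
begin

definition self_imp :: "('a \<Rightarrow> 'a \<Rightarrow> 'a) \<Rightarrow> 'a \<Rightarrow> 'a" where
  "self_imp imp x = imp x x"

definition inOL_le :: "('a \<Rightarrow> 'a \<Rightarrow> 'a) \<Rightarrow> 'a \<Rightarrow> 'a \<Rightarrow> bool" where
  "inOL_le imp x y \<longleftrightarrow> imp x y = self_imp imp (imp x y)"

definition inOL_q :: "('a \<Rightarrow> 'a \<Rightarrow> 'a) \<Rightarrow> ('a \<Rightarrow> 'a) \<Rightarrow> 'a \<Rightarrow> 'a \<Rightarrow> 'a \<Rightarrow> 'a" where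
  "inOL_q imp neg x y z =
     imp (imp x y) (imp (imp y x) (imp (imp (neg x) (neg y)) (imp (imp (neg y) (neg x)) z)))"

text \<open>Universes of algebras are explicit carrier sets and, as usual in universal algebra,
  nonempty.\<close>

locale inOL_algebra =
  fixes A :: "'a set"
    and imp :: "'a \<Rightarrow> 'a \<Rightarrow> 'a"  (infixr \<open>\<rightarrow>\<close> 60)
    and neg :: "'a \<Rightarrow> 'a"
  assumes nonempty: "A \<noteq> {}"
    and imp_closed: "\<lbrakk>x \<in> A; y \<in> A\<rbrakk> \<Longrightarrow> x \<rightarrow> y \<in> A"
    and neg_closed: "x \<in> A \<Longrightarrow> neg x \<in> A"
    and self_imp_left: "\<lbrakk>x \<in> A; y \<in> A\<rbrakk> \<Longrightarrow> self_imp imp x \<rightarrow> y = y"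
    and imp_distrib: "\<lbrakk>x \<in> A; y \<in> A; z \<in> A\<rbrakk> \<Longrightarrow> x \<rightarrow> (y \<rightarrow> z) = (x \<rightarrow> y) \<rightarrow> (x \<rightarrow> z)"
    and imp_exchange: "\<lbrakk>x \<in> A; y \<in> A; z \<in> A\<rbrakk> \<Longrightarrow> (x \<rightarrow> y) \<rightarrow> (x \<rightarrow> z) = y \<rightarrow> (x \<rightarrow> z)"
    and imp_peirce: "\<lbrakk>x \<in> A; y \<in> A\<rbrakk> \<Longrightarrow> ((x \<rightarrow> y) \<rightarrow> x) \<rightarrow> x = self_imp imp x"
    and le_imp: "\<lbrakk>x \<in> A; y \<in> A\<rbrakk> \<Longrightarrow> inOL_le imp x (y \<rightarrow> x)"
    and neg_neg: "x \<in> A \<Longrightarrow> neg (neg x) = x"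
    and neg_imp_self: "\<lbrakk>x \<in> A; y \<in> A\<rbrakk> \<Longrightarrow> x \<rightarrow> y = (neg x \<rightarrow> x) \<rightarrow> y"
    and imp_neg: "\<lbrakk>x \<in> A; y \<in> A\<rbrakk> \<Longrightarrow> x \<rightarrow> neg y = neg (x \<rightarrow> y)"
    and q_eq: "\<lbrakk>x \<in> A; y \<in> A\<rbrakk> \<Longrightarrow> inOL_q imp neg x y x = inOL_q imp neg x y y"

locale tarski_algebra =
  fixes T :: "'a set"
    and imp :: "'a \<Rightarrow> 'a \<Rightarrow> 'a"  (infixr \<open>\<rightarrow>\<close> 60)
    and top :: 'a
  assumes top_closed: "top \<in> T"
    and imp_closed: "\<lbrakk>x \<in> T; y \<in> T\<rbrakk> \<Longrightarrow> x \<rightarrow> y \<in> T"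
    and imp_weaken: "\<lbrakk>x \<in> T; y \<in> T\<rbrakk> \<Longrightarrow> x \<rightarrow> (y \<rightarrow> x) = top"
    and imp_distrib: "\<lbrakk>x \<in> T; y \<in> T; z \<in> T\<rbrakk> \<Longrightarrow> x \<rightarrow> (y \<rightarrow> z) = (x \<rightarrow> y) \<rightarrow> (x \<rightarrow> z)"
    and imp_antisym: "\<lbrakk>x \<in> T; y \<in> T; x \<rightarrow> y = top; y \<rightarrow> x = top\<rbrakk> \<Longrightarrow> x = y"
    and imp_peirce: "\<lbrakk>x \<in> T; y \<in> T\<rbrakk> \<Longrightarrow> ((x \<rightarrow> y) \<rightarrow> x) \<rightarrow> x = top"

definition twist_carrier :: "'a set \<Rightarrow> ('a \<Rightarrow> 'a \<Rightarrow> 'a) \<Rightarrow> ('a \<times> 'a) set" where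
  "twist_carrier T imp = {(a1, a2). a1 \<in> T \<and> a2 \<in> T \<and> imp a1 a2 = a2}"

definition twist_neg :: "'a \<times> 'a \<Rightarrow> 'a \<times> 'a" where
  "twist_neg x = (snd x, fst x)"

definition twist_imp :: "('a \<Rightarrow> 'a \<Rightarrow> 'a) \<Rightarrow> 'a \<times> 'a \<Rightarrow> 'a \<times> 'a \<Rightarrow> 'a \<times> 'a" where
  "twist_imp imp x y = (imp (fst x) (fst y), imp (fst x) (snd y))"

definition inOL_equiv :: "'a set \<Rightarrow> ('a \<Rightarrow> 'a \<Rightarrow> 'a) \<Rightarrow> ('a \<times> 'a) set" where
  "inOL_equiv A imp = {(x, y). x \<in> A \<and> y \<in> A \<and> inOL_le imp x y \<and> inOL_le imp y x}"

definition imp_congruence :: "'a set \<Rightarrow> ('a \<Rightarrow> 'a \<Rightarrow> 'a) \<Rightarrow> ('a \<times> 'a) set \<Rightarrow> bool" where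
  "imp_congruence A imp R \<longleftrightarrow> equiv A R \<and>
     (\<forall>x x' y y'. (x, x') \<in> R \<and> (y, y') \<in> R \<longrightarrow> (imp x y, imp x' y') \<in> R)"

text \<open>The induced operation on \<open>A // R\<close>. For a congruence \<open>R\<close> all the classes in the
  union coincide, so the value on \<open>R `` {x}\<close> and \<open>R `` {y}\<close> is \<open>R `` {imp x y}\<close>.\<close>

definition quotient_imp ::
    "('a \<times> 'a) set \<Rightarrow> ('a \<Rightarrow> 'a \<Rightarrow> 'a) \<Rightarrow> 'a set \<Rightarrow> 'a set \<Rightarrow> 'a set" where
  "quotient_imp R imp X Y = (\<Union>x\<in>X. \<Union>y\<in>Y. R `` {imp x y})"

definition algebra_embedding ::
    "'a set \<Rightarrow> ('a \<Rightarrow> 'a \<Rightarrow> 'a) \<Rightarrow> ('a \<Rightarrow> 'a) \<Rightarrow>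
     'b set \<Rightarrow> ('b \<Rightarrow> 'b \<Rightarrow> 'b) \<Rightarrow> ('b \<Rightarrow> 'b) \<Rightarrow> ('a \<Rightarrow> 'b) \<Rightarrow> bool" where
  "algebra_embedding A imp neg B imp' neg' h \<longleftrightarrow>
     h ` A \<subseteq> B \<and> inj_on h A \<and>
     (\<forall>x\<in>A. \<forall>y\<in>A. h (imp x y) = imp' (h x) (h y)) \<and>
     (\<forall>x\<in>A. h (neg x) = neg' (h x))"

end

theory Submission
  imports Defs
begin

text \<open>
  In an inOL-algebra the elements \<open>e\<close> with \<open>e \<rightarrow> e = e\<close> are exactly those that act as left
  identities of \<open>\<rightarrow>\<close>; call them units. Units play the part of the value ``true'': \<open>x \<preceq> y\<close> says
  that \<open>x \<rightarrow> y\<close> is a unit, every \<open>|x|\<close> is a unit, and the units form an up-set and a single class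
  of \<open>\<equiv>\<close>. With ``is a unit'' in place of ``equals 1'', the usual deductions for implication
  make \<open>\<preceq>\<close> a preorder for which \<open>\<rightarrow>\<close> is antitone on the left and monotone on the right; hence
  \<open>\<equiv>\<close> is a congruence of \<open>\<rightarrow>\<close>, and the quotient is a Tarski algebra with the class of units
  on top.

  Negation need not respect \<open>\<equiv>\<close>, so a class by itself forgets too much. The embedding
  therefore records two classes, \<open>x \<mapsto> ([x], [\<not>x])\<close>. The pair satisfies the twist condition because
  \<open>x \<rightarrow> \<not>x \<equiv> \<not>x\<close>, which comes from the law \<open>x \<rightarrow> y = (\<not>x \<rightarrow> x) \<rightarrow> y\<close> applied to \<open>\<not>x\<close>;
  it respects the operations because \<open>\<not>(x \<rightarrow> y) = x \<rightarrow> \<not>y\<close>. If \<open>x \<equiv> y\<close> and \<open>\<not>x \<equiv> \<not>y\<close>,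
  then all four premises in \<open>q(x,y,z)\<close> are units, so \<open>q(x,y,z) = z\<close> and the last law reads
  \<open>x = y\<close>: this is injectivity.

  That the twist construction over any Tarski algebra yields an inOL-algebra is a calculation
  in each coordinate. Its two less obvious ingredients both rely on Peirce's law: the condition
  \<open>a \<rightarrow> b = b\<close> is symmetric in \<open>a\<close> and \<open>b\<close>, so that swapping coordinates stays inside the
  carrier, and the join \<open>(a \<rightarrow> b) \<rightarrow> b\<close> is symmetric, which gives the law for \<open>q\<close>.
\<close>

section \<open>Tarski algebras\<close>

context tarski_algebra
begin

text \<open>Peirce's law writes \<open>top\<close> as some \<open>y \<rightarrow> x\<close> with the given \<open>x\<close>, which turns this equation
  into an instance of the weakening law.\<close>

lemma imp_top [simp]: "x \<in> T \<Longrightarrow> x \<rightarrow> top = top"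
  by (metis imp_closed imp_peirce imp_weaken)

lemma imp_refl [simp]:
  assumes x: "x \<in> T" shows "x \<rightarrow> x = top"
proof -
  have "top \<rightarrow> (x \<rightarrow> x) = top"
    using x imp_distrib[of x "x \<rightarrow> x" x] by (simp add: imp_weaken imp_closed)
  then show ?thesis
    using x by - (rule imp_antisym; simp add: imp_closed top_closed)
qed

lemma top_imp [simp]: "x \<in> T \<Longrightarrow> top \<rightarrow> x = x"
  using imp_peirce[of x x]
  by - (rule imp_antisym; simp add: imp_weaken imp_closed top_closed)

lemma le_trans:
  "\<lbrakk>x \<in> T; y \<in> T; z \<in> T; x \<rightarrow> y = top; y \<rightarrow> z = top\<rbrakk> \<Longrightarrow> x \<rightarrow> z = top"
  by (metis imp_closed imp_distrib imp_top top_imp)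

lemma imp_antitone:
  assumes "x \<in> T" "y \<in> T" "z \<in> T" and "x \<rightarrow> y = top"
  shows "(y \<rightarrow> z) \<rightarrow> (x \<rightarrow> z) = top"
proof -
  have "x \<rightarrow> (y \<rightarrow> z) = x \<rightarrow> z"
    using assms by (simp add: imp_distrib imp_closed)
  then show ?thesis
    using assms by (metis imp_closed imp_weaken)
qed

lemma imp_mono:
  "\<lbrakk>x \<in> T; y \<in> T; z \<in> T; x \<rightarrow> y = top\<rbrakk> \<Longrightarrow> (z \<rightarrow> x) \<rightarrow> (z \<rightarrow> y) = top"
  by (metis imp_distrib imp_top)

lemma imp_commute:
  assumes "x \<in> T" "y \<in> T" "z \<in> T"
  shows "x \<rightarrow> (y \<rightarrow> z) = y \<rightarrow> (x \<rightarrow> z)"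
proof -
  have "(a \<rightarrow> (b \<rightarrow> c)) \<rightarrow> (b \<rightarrow> (a \<rightarrow> c)) = top" if "a \<in> T" "b \<in> T" "c \<in> T" for a b c
    using that imp_antitone[of b "a \<rightarrow> b" "a \<rightarrow> c"]
    by (simp add: imp_distrib[of a b c] imp_weaken imp_closed)
  then show ?thesis
    using assms by - (rule imp_antisym; simp add: imp_closed)
qed

lemma imp_contract: "\<lbrakk>x \<in> T; y \<in> T\<rbrakk> \<Longrightarrow> x \<rightarrow> (x \<rightarrow> y) = x \<rightarrow> y"
  by (simp add: imp_distrib imp_closed)

lemma imp_exchange:
  "\<lbrakk>x \<in> T; y \<in> T; z \<in> T\<rbrakk> \<Longrightarrow> (x \<rightarrow> y) \<rightarrow> (x \<rightarrow> z) = y \<rightarrow> (x \<rightarrow> z)"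
  by (metis imp_distrib imp_commute)

text \<open>The condition \<open>x \<rightarrow> y = y\<close> says that the join of \<open>x\<close> and \<open>y\<close> is \<open>top\<close>, so it is
  symmetric; this is what lets a twist algebra be closed under swapping coordinates.\<close>

lemma imp_eq_right_sym:
  assumes "x \<in> T" "y \<in> T" "x \<rightarrow> y = y"
  shows "y \<rightarrow> x = x"
proof (rule imp_antisym)
  show "(y \<rightarrow> x) \<rightarrow> x = top"
    using assms imp_peirce[of x y] by simp
qed (use assms in \<open>auto intro: imp_closed imp_weaken\<close>)

text \<open>Classically both sides are the join of \<open>x\<close> and \<open>y\<close>. Each side \<open>w\<close> lies above \<open>x\<close> and
  \<open>y\<close>, and Peirce's law for \<open>w\<close> absorbs the premise of the other side.\<close>

lemma join_commute:
  assumes "x \<in> T" "y \<in> T"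
  shows "(x \<rightarrow> y) \<rightarrow> y = (y \<rightarrow> x) \<rightarrow> x"
proof -
  have "((a \<rightarrow> b) \<rightarrow> b) \<rightarrow> ((b \<rightarrow> a) \<rightarrow> a) = top" if ab: "a \<in> T" "b \<in> T" for a b
  proof -
    define w where "w = (b \<rightarrow> a) \<rightarrow> a"
    have w: "w \<in> T" "a \<rightarrow> w = top" "b \<rightarrow> w = top"
      using ab by (auto simp: w_def imp_closed imp_weaken imp_commute[of b "b \<rightarrow> a" a])
    have 1: "((a \<rightarrow> b) \<rightarrow> b) \<rightarrow> ((a \<rightarrow> b) \<rightarrow> w) = top"
      using ab w by (simp add: imp_mono imp_closed)
    have 2: "((a \<rightarrow> b) \<rightarrow> w) \<rightarrow> ((w \<rightarrow> b) \<rightarrow> w) = top"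
      using ab w by (simp add: imp_antitone imp_closed)
    have 3: "((w \<rightarrow> b) \<rightarrow> w) \<rightarrow> w = top"
      using ab w by (simp add: imp_peirce)
    have "((a \<rightarrow> b) \<rightarrow> b) \<rightarrow> w = top"
      using ab w by - (rule le_trans[OF _ _ _ le_trans[OF _ _ _ 1 2] 3]; simp add: imp_closed)
    then show ?thesis
      by (simp add: w_def)
  qed
  then show ?thesis
    using assms by - (rule imp_antisym; simp add: imp_closed)
qed

text \<open>Under the premises \<open>x \<rightarrow> y\<close> and \<open>y \<rightarrow> x\<close>, the elements \<open>x\<close> and \<open>y\<close> cannot be
  distinguished: both sides are the join of \<open>x\<close> and \<open>y\<close>.\<close>

lemma imp_imp_cong:
  assumes "x \<in> T" "y \<in> T"
  shows "(x \<rightarrow> y) \<rightarrow> ((y \<rightarrow> x) \<rightarrow> x) = (x \<rightarrow> y) \<rightarrow> ((y \<rightarrow> x) \<rightarrow> y)"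
proof -
  have "(x \<rightarrow> y) \<rightarrow> ((y \<rightarrow> x) \<rightarrow> x) = (x \<rightarrow> y) \<rightarrow> y"
    using assms by (simp add: join_commute[of y x] imp_contract imp_closed)
  also have "\<dots> = (y \<rightarrow> x) \<rightarrow> ((x \<rightarrow> y) \<rightarrow> y)"
    using assms by (simp add: join_commute[of x y] imp_contract imp_closed)
  also have "\<dots> = (x \<rightarrow> y) \<rightarrow> ((y \<rightarrow> x) \<rightarrow> y)"
    using assms by (simp add: imp_commute imp_closed)
  finally show ?thesis .
qed

section \<open>The twist algebra of a Tarski algebra\<close>

theorem twist_inOL_algebra:
  "inOL_algebra (twist_carrier T imp) (twist_imp imp) twist_neg"
proof -
  let ?C = "twist_carrier T imp"
  have C: "x \<in> ?C \<longleftrightarrow> fst x \<in> T \<and> snd x \<in> T \<and> fst x \<rightarrow> snd x = snd x" for x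
    by (cases x) (simp add: twist_carrier_def)
  note ops = twist_imp_def twist_neg_def self_imp_def inOL_le_def
  show ?thesis
  proof
    have "(top, top) \<in> ?C"
      by (simp add: C top_closed)
    then show "?C \<noteq> {}"
      by blast
  next
    fix x y assume xy: "x \<in> ?C" "y \<in> ?C"
    then show "twist_imp imp x y \<in> ?C"
      using imp_distrib[of "fst x" "fst y" "snd y"] by (simp add: C ops imp_closed)
    show "twist_imp imp (self_imp (twist_imp imp) x) y = y"
      using xy by (simp add: C ops)
    show "inOL_le (twist_imp imp) x (twist_imp imp y x)"
      using xy by (simp add: C ops imp_weaken imp_closed top_closed)
    show "twist_imp imp x y = twist_imp imp (twist_imp imp (twist_neg x) x) y"
      using xy imp_eq_right_sym[of "fst x" "snd x"] by (simp add: C ops)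
    show "twist_imp imp x (twist_neg y) = twist_neg (twist_imp imp x y)"
      by (simp add: ops)
    \<comment> \<open>Peirce's law makes the first coordinate of \<open>(x \<rightarrow> y) \<rightarrow> x\<close> equal to that of \<open>x\<close>, and
      the second coordinate of \<open>z \<rightarrow> x\<close> depends on \<open>z\<close> only through its first one.\<close>
    have "(fst x \<rightarrow> fst y) \<rightarrow> fst x = fst x"
      using xy by - (rule imp_antisym; simp add: C imp_peirce imp_weaken imp_closed)
    then show "twist_imp imp (twist_imp imp (twist_imp imp x y) x) x
        = self_imp (twist_imp imp) x"
      using xy by (simp add: C ops)
    obtain a b c d where x_def: "x = (a, b)" and y_def: "y = (c, d)"
      by fastforce
    have T: "a \<in> T" "b \<in> T" "c \<in> T" "d \<in> T"
      using xy by (auto simp: C x_def y_def)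
    \<comment> \<open>The premises about the first coordinates identify \<open>a\<close> with \<open>c\<close>; those about the second
      coordinates identify \<open>b\<close> with \<open>d\<close>.\<close>
    have q_fst: "(a \<rightarrow> c) \<rightarrow> ((c \<rightarrow> a) \<rightarrow> ((b \<rightarrow> d) \<rightarrow> ((d \<rightarrow> b) \<rightarrow> a)))
        = (a \<rightarrow> c) \<rightarrow> ((c \<rightarrow> a) \<rightarrow> ((b \<rightarrow> d) \<rightarrow> ((d \<rightarrow> b) \<rightarrow> c)))"
    proof -
      have "(a \<rightarrow> c) \<rightarrow> ((c \<rightarrow> a) \<rightarrow> ((b \<rightarrow> d) \<rightarrow> ((d \<rightarrow> b) \<rightarrow> z)))
          = (b \<rightarrow> d) \<rightarrow> ((d \<rightarrow> b) \<rightarrow> ((a \<rightarrow> c) \<rightarrow> ((c \<rightarrow> a) \<rightarrow> z)))" if "z \<in> T" for z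
        using T that by (simp add: imp_commute imp_closed)
      then show ?thesis
        using T imp_imp_cong[of a c] by simp
    qed
    have q_snd: "(a \<rightarrow> c) \<rightarrow> ((c \<rightarrow> a) \<rightarrow> ((b \<rightarrow> d) \<rightarrow> ((d \<rightarrow> b) \<rightarrow> b)))
        = (a \<rightarrow> c) \<rightarrow> ((c \<rightarrow> a) \<rightarrow> ((b \<rightarrow> d) \<rightarrow> ((d \<rightarrow> b) \<rightarrow> d)))"
      using T imp_imp_cong[of b d] by simp
    show "inOL_q (twist_imp imp) twist_neg x y x = inOL_q (twist_imp imp) twist_neg x y y"
      using q_fst q_snd by (simp add: inOL_q_def ops x_def y_def)
  next
    fix x y z assume xyz: "x \<in> ?C" "y \<in> ?C" "z \<in> ?C"
    then show "twist_imp imp x (twist_imp imp y z)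
        = twist_imp imp (twist_imp imp x y) (twist_imp imp x z)"
      by (simp add: C ops imp_distrib)
    show "twist_imp imp (twist_imp imp x y) (twist_imp imp x z)
        = twist_imp imp y (twist_imp imp x z)"
      using xyz by (simp add: C ops imp_exchange)
  next
    fix x assume "x \<in> ?C"
    then show "twist_neg x \<in> ?C" "twist_neg (twist_neg x) = x"
      using imp_eq_right_sym[of "fst x" "snd x"] by (simp_all add: C ops)
  qed
qed

end

section \<open>Units and the preorder of an inOL-algebra\<close>

context inOL_algebra
begin

definition units :: "'a set" where
  "units = {e \<in> A. e \<rightarrow> e = e}"

lemma unit_imp: "\<lbrakk>e \<in> units; y \<in> A\<rbrakk> \<Longrightarrow> e \<rightarrow> y = y"
  using self_imp_left[of e y] by (simp add: units_def self_imp_def)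

lemma self_imp_unit: "x \<in> A \<Longrightarrow> x \<rightarrow> x \<in> units"
  using self_imp_left[of x "x \<rightarrow> x"] by (simp add: units_def self_imp_def imp_closed)

lemma unit_closed: "e \<in> units \<Longrightarrow> e \<in> A"
  by (simp add: units_def)

lemma le_iff_unit: "\<lbrakk>x \<in> A; y \<in> A\<rbrakk> \<Longrightarrow> inOL_le imp x y \<longleftrightarrow> x \<rightarrow> y \<in> units"
  by (auto simp: inOL_le_def self_imp_def units_def imp_closed)

lemma weaken_unit: "\<lbrakk>x \<in> A; y \<in> A\<rbrakk> \<Longrightarrow> x \<rightarrow> (y \<rightarrow> x) \<in> units"
  using le_imp[of x y] le_iff_unit[of x "y \<rightarrow> x"] by (simp add: imp_closed)

text \<open>A unit \<open>e\<close> is a left identity, so the weakening law \<open>e \<preceq> x \<rightarrow> e\<close> loses its premise.\<close>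

lemma imp_unit: "\<lbrakk>x \<in> A; e \<in> units\<rbrakk> \<Longrightarrow> x \<rightarrow> e \<in> units"
  using weaken_unit[of e x] unit_imp[of e "x \<rightarrow> e"] by (simp add: imp_closed unit_closed)

lemma le_trans:
  assumes "x \<in> A" "y \<in> A" "z \<in> A" and xy: "x \<rightarrow> y \<in> units" and yz: "y \<rightarrow> z \<in> units"
  shows "x \<rightarrow> z \<in> units"
proof -
  have "x \<rightarrow> (y \<rightarrow> z) \<in> units"
    using assms by (simp add: imp_unit)
  then show ?thesis
    using assms by (simp add: imp_distrib unit_imp imp_closed)
qed

lemma imp_mono:
  assumes "x \<in> A" "y \<in> A" "z \<in> A" and "x \<rightarrow> y \<in> units"
  shows "(z \<rightarrow> x) \<rightarrow> (z \<rightarrow> y) \<in> units"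
  using assms imp_unit[of z "x \<rightarrow> y"] by (simp add: imp_distrib)

lemma imp_antitone:
  assumes "x \<in> A" "y \<in> A" "z \<in> A" and "x \<rightarrow> y \<in> units"
  shows "(y \<rightarrow> z) \<rightarrow> (x \<rightarrow> z) \<in> units"
proof -
  have "x \<rightarrow> (y \<rightarrow> z) = x \<rightarrow> z"
    using assms by (simp add: imp_distrib unit_imp imp_closed)
  then show ?thesis
    using assms weaken_unit[of "y \<rightarrow> z" x] by (simp add: imp_closed)
qed

section \<open>The quotient Tarski algebra\<close>

abbreviation equiv_rel :: "('a \<times> 'a) set" where
  "equiv_rel \<equiv> inOL_equiv A imp"

lemma equiv_rel_iff:
  "(x, y) \<in> equiv_rel \<longleftrightarrow> x \<in> A \<and> y \<in> A \<and> x \<rightarrow> y \<in> units \<and> y \<rightarrow> x \<in> units"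
  by (auto simp: inOL_equiv_def le_iff_unit)

lemma equiv_equiv_rel: "equiv A equiv_rel"
proof (rule equivI)
  show "equiv_rel \<subseteq> A \<times> A"
    by (auto simp: equiv_rel_iff)
  show "refl_on A equiv_rel"
    by (auto simp: refl_on_def equiv_rel_iff self_imp_unit)
  show "sym equiv_rel"
    by (auto simp: sym_def equiv_rel_iff)
  show "trans equiv_rel"
    unfolding trans_def equiv_rel_iff using le_trans by blast
qed

lemma imp_respects:
  assumes "(x, x') \<in> equiv_rel" "(y, y') \<in> equiv_rel"
  shows "(x \<rightarrow> y, x' \<rightarrow> y') \<in> equiv_rel"
proof -
  have "(a \<rightarrow> b) \<rightarrow> (a' \<rightarrow> b') \<in> units"
    if "(a, a') \<in> equiv_rel" "(b, b') \<in> equiv_rel" for a a' b b'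
  proof -
    have "(a \<rightarrow> b) \<rightarrow> (a' \<rightarrow> b) \<in> units" "(a' \<rightarrow> b) \<rightarrow> (a' \<rightarrow> b') \<in> units"
      using that by (auto simp: equiv_rel_iff imp_antitone imp_mono)
    then show ?thesis
      using that le_trans by (meson equiv_rel_iff imp_closed)
  qed
  then show ?thesis
    using assms by (simp add: equiv_rel_iff imp_closed)
qed

theorem imp_congruence_equiv_rel: "imp_congruence A imp equiv_rel"
  using equiv_equiv_rel imp_respects by (auto simp: imp_congruence_def)

abbreviation cls :: "'a \<Rightarrow> 'a set" where
  "cls x \<equiv> equiv_rel `` {x}"

abbreviation qimp :: "'a set \<Rightarrow> 'a set \<Rightarrow> 'a set" where
  "qimp \<equiv> quotient_imp equiv_rel imp"

lemma cls_eq_iff: "\<lbrakk>x \<in> A; y \<in> A\<rbrakk> \<Longrightarrow> cls x = cls y \<longleftrightarrow> x \<rightarrow> y \<in> units \<and> y \<rightarrow> x \<in> units"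
  using eq_equiv_class_iff[OF equiv_equiv_rel] by (simp add: equiv_rel_iff)

lemma qimp_cls:
  assumes "x \<in> A" "y \<in> A"
  shows "qimp (cls x) (cls y) = cls (x \<rightarrow> y)"
proof -
  have "congruent2 equiv_rel equiv_rel (\<lambda>x y. cls (x \<rightarrow> y))"
    unfolding congruent2_def
    using imp_respects equiv_class_eq[OF equiv_equiv_rel] by blast
  then show ?thesis
    unfolding quotient_imp_def
    using UN_equiv_class2[OF equiv_equiv_rel equiv_equiv_rel] assms by blast
qed

text \<open>This turns equations with the top of the quotient into membership in the set of units.\<close>

lemma cls_eq_unit_iff: "\<lbrakk>x \<in> A; e \<in> units\<rbrakk> \<Longrightarrow> cls x = cls e \<longleftrightarrow> x \<in> units"
  by (simp add: cls_eq_iff unit_closed imp_unit unit_imp)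

theorem quotient_tarski_algebra:
  assumes "a \<in> A"
  shows "tarski_algebra (A // equiv_rel) qimp (cls (a \<rightarrow> a))"
proof -
  have top: "cls x = cls (a \<rightarrow> a) \<longleftrightarrow> x \<in> units" if "x \<in> A" for x
    using that assms by (simp add: cls_eq_unit_iff self_imp_unit)
  show ?thesis
  proof
    show "cls (a \<rightarrow> a) \<in> A // equiv_rel"
      using assms by (simp add: quotientI imp_closed)
  next
    fix X Y assume "X \<in> A // equiv_rel" "Y \<in> A // equiv_rel"
    then obtain x y where xy: "x \<in> A" "y \<in> A" and X: "X = cls x" and Y: "Y = cls y"
      by (auto elim!: quotientE)
    show "qimp X Y \<in> A // equiv_rel"
      using xy by (simp add: X Y qimp_cls quotientI imp_closed)
    show "qimp X (qimp Y X) = cls (a \<rightarrow> a)"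
      using xy by (simp add: X Y qimp_cls top imp_closed weaken_unit)
    show "qimp (qimp (qimp X Y) X) X = cls (a \<rightarrow> a)"
      using xy imp_peirce[of x y]
      by (simp add: X Y qimp_cls top imp_closed self_imp_def self_imp_unit)
    show "X = Y" if "qimp X Y = cls (a \<rightarrow> a)" "qimp Y X = cls (a \<rightarrow> a)"
      using xy that by (simp add: X Y qimp_cls top imp_closed cls_eq_iff)
  next
    fix X Y Z assume "X \<in> A // equiv_rel" "Y \<in> A // equiv_rel" "Z \<in> A // equiv_rel"
    then obtain x y z where "x \<in> A" "y \<in> A" "z \<in> A" and "X = cls x" "Y = cls y" "Z = cls z"
      by (auto elim!: quotientE)
    then show "qimp X (qimp Y Z) = qimp (qimp X Y) (qimp X Z)"
      using imp_distrib[of x y z] by (simp add: qimp_cls imp_closed)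
  qed
qed

section \<open>The embedding\<close>

text \<open>Substituting \<open>\<not>x\<close> for \<open>x\<close> in \<open>x \<rightarrow> y = (\<not>x \<rightarrow> x) \<rightarrow> y\<close> turns \<open>(x \<rightarrow> \<not>x) \<rightarrow> \<not>x\<close> into
  \<open>|\<not>x|\<close>; this puts the pair \<open>([x], [\<not>x])\<close> into the twist algebra.\<close>

lemma cls_imp_neg:
  assumes "x \<in> A"
  shows "cls (x \<rightarrow> neg x) = cls (neg x)"
proof -
  have "(x \<rightarrow> neg x) \<rightarrow> neg x = neg x \<rightarrow> neg x"
    using assms neg_imp_self[of "neg x" "neg x"] by (simp add: neg_closed neg_neg)
  then show ?thesis
    using assms by (simp add: cls_eq_iff imp_closed neg_closed weaken_unit self_imp_unit)
qed

lemma eq_if_cls_eq: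
  assumes xy: "x \<in> A" "y \<in> A" and "cls x = cls y" "cls (neg x) = cls (neg y)"
  shows "x = y"
proof -
  have "x \<rightarrow> y \<in> units" "y \<rightarrow> x \<in> units"
       "neg x \<rightarrow> neg y \<in> units" "neg y \<rightarrow> neg x \<in> units"
    using assms by (simp_all add: cls_eq_iff neg_closed)
  then have "inOL_q imp neg x y z = z" if "z \<in> A" for z
    using that by (simp add: inOL_q_def unit_imp)
  then show ?thesis
    using q_eq[of x y] xy by simp
qed

theorem twist_embedding:
  "algebra_embedding A imp neg (twist_carrier (A // equiv_rel) qimp) (twist_imp qimp) twist_neg
     (\<lambda>x. (cls x, cls (neg x)))"
  unfolding algebra_embedding_def
proof (intro conjI ballI)
  show "(\<lambda>x. (cls x, cls (neg x))) ` A \<subseteq> twist_carrier (A // equiv_rel) qimp"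
    by (auto simp: twist_carrier_def qimp_cls cls_imp_neg neg_closed quotientI)
  show "inj_on (\<lambda>x. (cls x, cls (neg x))) A"
    by (rule inj_onI) (blast intro: eq_if_cls_eq)
next
  fix x assume "x \<in> A"
  then show "(cls (neg x), cls (neg (neg x))) = twist_neg (cls x, cls (neg x))"
    by (simp add: twist_neg_def neg_neg)
next
  fix x y assume "x \<in> A" "y \<in> A"
  then show "(cls (x \<rightarrow> y), cls (neg (x \<rightarrow> y)))
      = twist_imp qimp (cls x, cls (neg x)) (cls y, cls (neg y))"
    by (simp add: twist_imp_def qimp_cls neg_closed imp_neg)
qed

end

theorem theorem12:
  fixes A :: "'a set" and imp :: "'a \<Rightarrow> 'a \<Rightarrow> 'a" and neg :: "'a \<Rightarrow> 'a"
  assumes "inOL_algebra A imp neg"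
  defines "R \<equiv> inOL_equiv A imp"
  defines "Q \<equiv> A // R"
  defines "qimp \<equiv> quotient_imp R imp"
  shows "imp_congruence A imp R \<and>
    (\<forall>a\<in>A. tarski_algebra Q qimp (R `` {imp a a})) \<and>
    inOL_algebra (twist_carrier Q qimp) (twist_imp qimp) twist_neg \<and>
    (\<exists>h. algebra_embedding A imp neg
           (twist_carrier Q qimp) (twist_imp qimp) twist_neg h)"
proof -
  interpret inOL_algebra A imp neg
    by (rule assms(1))
  obtain a where "a \<in> A"
    using nonempty by blast
  then have "inOL_algebra (twist_carrier Q qimp) (twist_imp qimp) twist_neg"
    unfolding Q_def qimp_def R_def
    by (rule tarski_algebra.twist_inOL_algebra[OF quotient_tarski_algebra])
  then show ?thesis
    using imp_congruence_equiv_rel quotient_tarski_algebra twist_embedding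
    unfolding Q_def qimp_def R_def by blast
qed

end
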